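(* Let $\mathbb{S}$ denote the set of $T$-even matrix polynomials in $\mathbb{P}_m(\mathbb{C}^{n\times n})$. Let $P\in\mathbb{S}$ be regular and let $(\lambda,x)\in\mathbb{C}\times\mathbb{C}^n$ be such that $x^Hx=1$. Set $r:=-P(\lambda)x$, $P_x:=I-xx^H$ and $\Lambda_m:=[1,\lambda,\ldots,\lambda^m]^T$. Then $$\eta_F^{\mathbb{S}}(\lambda,x,P)=\sqrt{\frac{|x^Tr|^2}{\|\Pi_e(\Lambda_m)\|_2^2}+2\,\frac{\|r\|_2^2-|x^Tr|^2}{\|\Lambda_m\|_2^2}},\qquad \eta_2^{\mathbb{S}}(\lambda,x,P)=\sqrt{\frac{|x^Tr|^2}{\|\Pi_e(\Lambda_m)\|_2^2}+\frac{\|r\|_2^2-|x^Tr|^2}{\|\Lambda_m\|_2^2}}.$$ In particular, if $m$ is odd and $|\lambda|=1$, then $\eta_F^{\mathbb{S}}(\lambda,x,P)=\sqrt2\,\eta(\lambda,x,P)$ and $\eta_2^{\mathbb{S}}(\lambda,x,P)=\eta(\lambda,x,P)$. For $j=0,\ldots,m$ define $$E_j:=\begin{cases}\dfrac{\overline{\lambda^j}}{\|\Pi_e(\Lambda_m)\|_2^2}(x^Tr)\,\overline{x}x^H+\dfrac{\overline{\lambda^j}}{\|\Lambda_m\|_2^2}\left[\overline{x}r^TP_x+P_x^Trx^H\right],& j\text{ even},\\[2mm] \dfrac{\overline{\lambda^j}}{\|\Lambda_m\|_2^2}\left[P_x^Trx^H-\overline{x}r^TP_x\right],& j\text{ odd}.\end{cases}$$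 Then $\Delta P(z):=\sum_{j=0}^m z^jE_j$ is a unique $T$-even polynomial in $\mathbb{S}$ such that $P(\lambda)x+\Delta P(\lambda)x=0$ and $|||\Delta P|||_F=\eta_F^{\mathbb{S}}(\lambda,x,P)$. Further, for $j=0,\ldots,m$ define $$\Delta A_j:=\begin{cases}E_j-\dfrac{\overline{\lambda^j}\;\overline{x^Tr}\;P_x^Trr^TP_x}{\|\Pi_e(\Lambda_m)\|_2^2\,(\|r\|_2^2-|x^Tr|^2)},& j\text{ even},\\[2mm] E_j,& j\text{ odd},\end{cases}$$ where the subtracted term is taken to be $0$ if $|x^Tr|=\|r\|_2$. Then $\Delta P(z):=\sum_{j=0}^m z^j\Delta A_j$ is a $T$-even polynomial in $\mathbb{S}$ such that $P(\lambda)x+\Delta P(\lambda)x=0$ and $|||\Delta P|||_2=\eta_2^{\mathbb{S}}(\lambda,x,P)$.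
   Context: $m,n\ge1$ are integers. $\mathbb{P}_m(\mathbb{C}^{n\times n})$ is the vector space of matrix polynomials $P(z)=\sum_{j=0}^m z^jA_j$ with $A_j\in\mathbb{C}^{n\times n}$ (degree at most $m$). $P$ is regular if $\det P(z)\ne0$ for some $z\in\mathbb{C}$. $P$ is $T$-even if $P(z)^T=P(-z)$ for all $z$, i.e. $A_j$ is symmetric for $j$ even (including $j=0$) and skew-symmetric for $j$ odd. $\Pi_e:\mathbb{C}^{m+1}\to\mathbb{C}^{m+1}$ is the even index projection: it maps $[x_0,x_1,\ldots,x_m]^T$ to the vector obtained by replacing $x_j$ by $0$ for every odd $j$ and keeping $x_j$ for every even $j$. Bars denote entrywise complex conjugation. For $M\in\{2,F\}$, $|||P|||_M:=\left(\sum_{j=0}^m\|A_j\|_M^2\right)^{1/2}$, where for matrices $\|\cdot\|_F$ is the Frobenius norm and $\|\cdot\|_2$ the spectral norm. For $P$ regular, $\lambda\in\mathbb{C}$ and $x\in\mathbb{C}^n$ with $x^Hx=1$, the unstructured backward error is $\eta(\lambda,x,P):=\inf\{|||\Delta P|||_M:\Delta P\in\mathbb{P}_m(\mathbb{C}^{n\times n}),\ P(\lambda)x+\Delta P(\lambda)x=0\}$, which equals $\|P(\lambda)x\|_2/\|\Lambda_m\|_2$ for both $M=2$ and $M=F$. For $P\in\mathbb{S}$ the structured backward error is $\eta_M^{\mathbb{S}}(\lambda,x,P):=\inf\{|||\Delta P|||_M:\Delta P\in\mathbb{S},\ P(\lambda)x+\Delta P(\lambda)x=0\}$.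
   Formalization: For m odd and |λ|=1, the claim η_2^S=η is replaced by "η_2^S=η if and only if x^T r=0", since it fails otherwise (n=m=1, P=1, λ=x=1: η_2^S=1 but η=1/√2); all other clauses are as stated. *)

theory Defs
  imports "HOL-Analysis.Analysis" "HOL-Computational_Algebra.Polynomial"
begin

text \<open>
  A matrix polynomial is a library polynomial whose coefficients are matrices. The library's
  \<open>poly\<close> must not be used to evaluate it: the ring product on \<open>complex ^ 'n ^ 'n\<close> is entrywise.
\<close>

type_synonym 'n matpoly = "(complex ^ 'n ^ 'n) poly"

definition mscale :: "complex \<Rightarrow> complex ^ 'n ^ 'n \<Rightarrow> complex ^ 'n ^ 'n"  (infixr "*\<^sub>m" 75)
  where "c *\<^sub>m A = map_matrix ((*) c) A"

definition mpeval :: "'n::finite matpoly \<Rightarrow> complex \<Rightarrow> complex ^ 'n ^ 'n"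
  where "mpeval P z = (\<Sum>j\<le>degree P. z ^ j *\<^sub>m coeff P j)"

definition matpolys :: "nat \<Rightarrow> 'n::finite matpoly set"
  where "matpolys m = {P. degree P \<le> m}"

definition regular :: "'n::finite matpoly \<Rightarrow> bool"
  where "regular P \<longleftrightarrow> (\<exists>z. det (mpeval P z) \<noteq> 0)"

definition T_even :: "nat \<Rightarrow> 'n::finite matpoly set"
  where "T_even m = {P \<in> matpolys m. \<forall>z. transpose (mpeval P z) = mpeval P (- z)}"


definition conjv :: "complex ^ 'n \<Rightarrow> complex ^ 'n"
  where "conjv x = (\<chi> i. cnj (x $ i))"

text \<open>The bilinear products \<open>u\<^sup>T v\<close> and \<open>u v\<^sup>T\<close>; neither conjugates. Thus \<open>x\<^sup>H y\<close> is
  \<open>tdot (conjv x) y\<close> and \<open>x y\<^sup>H\<close> is \<open>outer x (conjv y)\<close>.\<close>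

definition tdot :: "complex ^ 'n::finite \<Rightarrow> complex ^ 'n \<Rightarrow> complex"
  where "tdot u v = (\<Sum>i\<in>UNIV. u $ i * v $ i)"

definition outer :: "complex ^ 'n \<Rightarrow> complex ^ 'n \<Rightarrow> complex ^ 'n ^ 'n"
  where "outer u v = (\<chi> i j. u $ i * v $ j)"

definition proj_perp :: "complex ^ 'n::finite \<Rightarrow> complex ^ 'n ^ 'n"
  where "proj_perp x = mat 1 - outer x (conjv x)"


text \<open>Vectors \<open>[x\<^sub>0, \<dots>, x\<^sub>m]\<^sup>T\<close> are functions on \<open>nat\<close> of which only the values at
  \<open>0, \<dots>, m\<close> are used.\<close>

definition Lam :: "complex \<Rightarrow> nat \<Rightarrow> complex"
  where "Lam lam j = lam ^ j"

definition Pi_e :: "(nat \<Rightarrow> complex) \<Rightarrow> nat \<Rightarrow> complex"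
  where "Pi_e v j = (if odd j then 0 else v j)"

definition norm2 :: "nat \<Rightarrow> (nat \<Rightarrow> complex) \<Rightarrow> real"
  where "norm2 m v = L2_set (\<lambda>j. cmod (v j)) {..m}"


definition frobenius_norm :: "complex ^ 'n::finite ^ 'n \<Rightarrow> real"
  where "frobenius_norm A = sqrt (\<Sum>i\<in>UNIV. \<Sum>j\<in>UNIV. (cmod (A $ i $ j))\<^sup>2)"

definition spectral_norm :: "complex ^ 'n::finite ^ 'n \<Rightarrow> real"
  where "spectral_norm A = onorm (\<lambda>x. A *v x)"

definition mpnorm :: "(complex ^ 'n ^ 'n \<Rightarrow> real) \<Rightarrow> nat \<Rightarrow> 'n::finite matpoly \<Rightarrow> real"
  where "mpnorm N m P = sqrt (\<Sum>j\<le>m. (N (coeff P j))\<^sup>2)"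

text \<open>The perturbations range over \<open>S\<close>: \<open>matpolys m\<close> gives the unstructured backward error,
  \<open>T_even m\<close> the structured one.\<close>

definition backward_error ::
  "(complex ^ 'n ^ 'n \<Rightarrow> real) \<Rightarrow> nat \<Rightarrow> 'n::finite matpoly set \<Rightarrow>
    complex \<Rightarrow> complex ^ 'n \<Rightarrow> 'n matpoly \<Rightarrow> real"
  where "backward_error N m S lam x P =
    Inf {mpnorm N m D | D. D \<in> S \<and> mpeval P lam *v x + mpeval D lam *v x = 0}"


definition E_coeff ::
  "nat \<Rightarrow> complex \<Rightarrow> complex ^ 'n \<Rightarrow> complex ^ 'n \<Rightarrow> nat \<Rightarrow> complex ^ 'n::finite ^ 'n"
  where "E_coeff m lam x r j =
    (if even j then
       (cnj (lam ^ j) / of_real ((norm2 m (Pi_e (Lam lam)))\<^sup>2) * tdot x r) *\<^sub>m outer (conjv x) (conjv x)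
       + (cnj (lam ^ j) / of_real ((norm2 m (Lam lam))\<^sup>2)) *\<^sub>m
           (outer (conjv x) r ** proj_perp x + transpose (proj_perp x) ** outer r (conjv x))
     else
       (cnj (lam ^ j) / of_real ((norm2 m (Lam lam))\<^sup>2)) *\<^sub>m
           (transpose (proj_perp x) ** outer r (conjv x) - outer (conjv x) r ** proj_perp x))"

definition DA_coeff ::
  "nat \<Rightarrow> complex \<Rightarrow> complex ^ 'n \<Rightarrow> complex ^ 'n \<Rightarrow> nat \<Rightarrow> complex ^ 'n::finite ^ 'n"
  where "DA_coeff m lam x r j =
    (if even j then
       E_coeff m lam x r j -
         (if cmod (tdot x r) = norm r then 0
          else (cnj (lam ^ j) * cnj (tdot x r) /
                 of_real ((norm2 m (Pi_e (Lam lam)))\<^sup>2 * ((norm r)\<^sup>2 - (cmod (tdot x r))\<^sup>2))) *\<^sub>m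
               (transpose (proj_perp x) ** outer r r ** proj_perp x))
     else E_coeff m lam x r j)"

definition mp_of :: "nat \<Rightarrow> (nat \<Rightarrow> complex ^ 'n ^ 'n) \<Rightarrow> 'n::finite matpoly"
  where "mp_of m A = (\<Sum>j\<le>m. monom (A j) j)"

end

theory Submission
  imports Defs
begin

text \<open>
  Put \<open>a = x\<^sup>T r\<close> and \<open>s = P\<^sub>x\<^sup>T r = r - a x\<^sup>c\<close>, where \<open>x\<^sup>c\<close> is the conjugate of \<open>x\<close>, so that
  \<open>x\<^sup>T s = 0\<close>. For a T-even \<open>Q\<close> with coefficients \<open>Q\<^sub>j\<close>, the real Frobenius inner product with \<open>E\<close>
  depends on \<open>Q(\<lambda>)x\<close> alone, because \<open>x\<^sup>T Q\<^sub>j x = 0\<close> for odd \<open>j\<close>. Hence \<open>E\<close> is the orthogonal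
  projection of the origin onto the affine space of admissible perturbations, which gives the
  Frobenius error and uniqueness. The vectors \<open>E\<^sub>j x\<close> are likewise the projection of the origin onto
  the set of admissible families \<open>Q\<^sub>j x\<close>, which bounds the spectral error from below. The bound is
  attained because the correction in \<open>\<Delta>A\<^sub>j\<close> is the Davis-Kahan-Weinberger completion: it makes
  \<open>\<Delta>A\<^sub>j\<close> a multiple of an isometry on the span of \<open>x\<close> and the conjugate of \<open>s\<close>.
\<close>

section \<open>Vectors and rank-one matrices\<close>

lemma conjv_conjv [simp]: "conjv (conjv v) = v"
  by (simp add: conjv_def vec_eq_iff)

lemma norm_conjv [simp]: "norm (conjv v) = norm v"
  by (simp add: conjv_def norm_vec_def)

lemma conjv_add [simp]: "conjv (u + v) = conjv u + conjv v"
  by (simp add: conjv_def vec_eq_iff)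

lemma conjv_scale [simp]: "conjv (c *s v) = cnj c *s conjv v"
  by (simp add: conjv_def vec_eq_iff)

lemma tdot_commute: "tdot u v = tdot v u"
  by (simp add: tdot_def mult.commute)

lemma cnj_tdot: "cnj (tdot u v) = tdot (conjv u) (conjv v)"
  by (simp add: tdot_def conjv_def)

lemma tdot_simps [simp]:
  "tdot u (v + w) = tdot u v + tdot u w"
  "tdot u (v - w) = tdot u v - tdot u w"
  "tdot u (- v) = - tdot u v"
  "tdot u (c *s v) = c * tdot u v"
  "tdot u 0 = 0"
  "tdot (u + v) w = tdot u w + tdot v w"
  "tdot (u - v) w = tdot u w - tdot v w"
  "tdot (c *s v) u = c * tdot v u"
  "tdot 0 u = 0"
  by (simp_all add: tdot_def algebra_simps sum.distrib sum_subtractf sum_distrib_left sum_negf)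

lemma tdot_sum: "tdot u (sum f A) = (\<Sum>j\<in>A. tdot u (f j))"
  by (induction A rule: infinite_finite_induct) auto

lemma inner_tdot: "u \<bullet> v = Re (tdot (conjv u) v)"
  by (simp add: inner_vec_def tdot_def conjv_def inner_complex_def)

lemma tdot_conjv_self: "tdot (conjv v) v = of_real ((norm v)\<^sup>2)"
proof -
  have "Im (tdot (conjv v) v) = 0"
    by (simp add: tdot_def conjv_def algebra_simps)
  moreover have "Re (tdot (conjv v) v) = (norm v)\<^sup>2"
    by (simp add: inner_tdot [symmetric] power2_norm_eq_inner)
  ultimately show ?thesis
    by (simp add: complex_eq_iff)
qed

lemma norm_vector_scalar_mult [simp]: "norm (c *s v) = cmod c * norm (v :: complex ^ 'n)"
  by (simp add: norm_vec_def norm_mult L2_set_right_distrib)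

lemma norm_tdot_le: "cmod (tdot u v) \<le> norm u * norm v"
proof -
  have "cmod (tdot u v) \<le> (\<Sum>i\<in>UNIV. \<bar>cmod (u $ i)\<bar> * \<bar>cmod (v $ i)\<bar>)"
    unfolding tdot_def by (rule order_trans [OF norm_sum]) (simp add: norm_mult)
  also have "\<dots> \<le> norm u * norm v"
    unfolding norm_vec_def by (rule L2_set_mult_ineq)
  finally show ?thesis .
qed

lemma norm_add_orthogonal:
  assumes "tdot (conjv u) v = 0"
  shows "(norm (c *s u + d *s v))\<^sup>2 = (cmod c)\<^sup>2 * (norm u)\<^sup>2 + (cmod d)\<^sup>2 * (norm v)\<^sup>2"
proof -
  have "(c *s u) \<bullet> (d *s v) = 0"
    using assms by (simp add: inner_tdot)
  then show ?thesis
    by (simp add: norm_add_Pythagorean orthogonal_def power_mult_distrib)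
qed

section \<open>Rank-one matrices, scaling and transposition\<close>

lemma mscale_mult_vec [simp]: "(c *\<^sub>m A) *v v = c *s (A *v v)"
  by (simp add: mscale_def matrix_vector_mult_def map_matrix_def vec_eq_iff sum_distrib_left
      mult.assoc)

lemma outer_mult_vec [simp]: "outer u v *v w = tdot v w *s u"
  by (simp add: outer_def matrix_vector_mult_def tdot_def vec_eq_iff sum_distrib_left mult_ac)

lemma transpose_outer [simp]: "transpose (outer u v) = outer v u"
  by (simp add: outer_def transpose_def vec_eq_iff)

lemma transpose_mscale [simp]: "transpose (c *\<^sub>m A) = c *\<^sub>m transpose A"
  by (simp add: mscale_def transpose_def map_matrix_def vec_eq_iff)

lemma transpose_add: "transpose (A + B) = transpose A + transpose B"
  by (simp add: transpose_def vec_eq_iff)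

lemma transpose_diff: "transpose (A - B) = transpose A - transpose B"
  by (simp add: transpose_def vec_eq_iff)

lemma mscale_simps:
  "c *\<^sub>m (A + B) = c *\<^sub>m A + c *\<^sub>m B"
  "c *\<^sub>m (A - B) = c *\<^sub>m A - c *\<^sub>m B"
  "c *\<^sub>m d *\<^sub>m A = (c * d) *\<^sub>m A"
  "0 *\<^sub>m A = 0" "1 *\<^sub>m A = A"
  "c *\<^sub>m 0 = 0"
  "(- c) *\<^sub>m A = - (c *\<^sub>m A)"
  by (simp_all add: mscale_def map_matrix_def vec_eq_iff algebra_simps)

lemma matrix_mult_outer: "A ** outer u v = outer (A *v u) v"
  by (simp add: outer_def matrix_matrix_mult_def matrix_vector_mult_def vec_eq_iff
      sum_distrib_left mult_ac)

lemma outer_matrix_mult: "outer u v ** A = outer u (v v* A)"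
  by (simp add: outer_def matrix_matrix_mult_def vector_matrix_mult_def vec_eq_iff
      sum_distrib_left mult_ac)

text \<open>The inner product conjugates its first argument entrywise, so pairing with a rank-one
  matrix evaluates the bilinear form of \<open>A\<close> at the conjugated factors. This is what
  makes pairings with \<open>E_coeff\<close> computable.\<close>

lemma inner_mscale_outer:
  "(c *\<^sub>m outer u v) \<bullet> A = Re (cnj c * tdot (conjv u) (A *v conjv v))"
proof -
  have "a \<bullet> b = Re (cnj a * b)" for a b :: complex
    by (simp add: inner_complex_def)
  then show ?thesis
    by (simp add: mscale_def outer_def map_matrix_def inner_vec_def tdot_def conjv_def
        matrix_vector_mult_def sum_distrib_left mult_ac del: times_complex.sel
        flip: Re_sum)
qed

lemma tdot_transpose: "tdot u (transpose A *v v) = tdot v (A *v u)"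
proof -
  have "tdot u (transpose A *v v) = (\<Sum>i\<in>UNIV. \<Sum>j\<in>UNIV. u $ i * (A $ j $ i * v $ j))"
    by (simp add: tdot_def matrix_vector_mult_def transpose_def sum_distrib_left)
  also have "\<dots> = (\<Sum>j\<in>UNIV. \<Sum>i\<in>UNIV. u $ i * (A $ j $ i * v $ j))"
    by (rule sum.swap)
  finally show ?thesis
    by (simp add: tdot_def matrix_vector_mult_def sum_distrib_left mult_ac)
qed

text \<open>The simplifier turns \<open>transpose (proj_perp x) *v r\<close> into
  \<open>r v* proj_perp x\<close>, so this one rule rewrites every projected residual in
  \<open>E_coeff\<close> and \<open>DA_coeff\<close>.\<close>

lemma vector_mult_proj_perp: "r v* proj_perp x = r - tdot x r *s conjv x"
proof -
  have "transpose (proj_perp x) *v r = r - tdot x r *s conjv x"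
    by (simp add: proj_perp_def transpose_diff matrix_vector_mult_diff_rdistrib
        del: transpose_matrix_vector)
  then show ?thesis by simp
qed


section \<open>Norms and evaluation of matrix polynomials\<close>

lemma frobenius_norm_eq_norm: "frobenius_norm A = norm A"
  by (simp add: frobenius_norm_def norm_vec_def L2_set_def sum_nonneg)

lemma bounded_linear_matrix_vector: "bounded_linear (\<lambda>v. (A :: complex ^ 'n ^ 'm) *v v)"
  by (rule matrix_vector_mul_bounded_linear)

lemma spectral_norm_nonneg: "0 \<le> spectral_norm A"
  unfolding spectral_norm_def by (rule onorm_pos_le [OF bounded_linear_matrix_vector])

lemma norm_mult_vec_le_spectral: "norm (A *v v) \<le> spectral_norm A * norm v"
  unfolding spectral_norm_def by (rule onorm [OF bounded_linear_matrix_vector])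

lemma spectral_norm_le:
  assumes "0 \<le> b" "\<And>v. (norm (A *v v))\<^sup>2 \<le> b * (norm v)\<^sup>2"
  shows "(spectral_norm A)\<^sup>2 \<le> b"
proof -
  have "norm (A *v v) \<le> sqrt b * norm v" for v
    using real_sqrt_le_mono [OF assms(2) [of v]] by (simp add: real_sqrt_mult)
  then have "spectral_norm A \<le> sqrt b"
    unfolding spectral_norm_def by (intro onorm_bound) (auto simp: assms(1))
  then have "(spectral_norm A)\<^sup>2 \<le> (sqrt b)\<^sup>2"
    by (intro power_mono spectral_norm_nonneg)
  with assms(1) show ?thesis by simp
qed

text \<open>Cauchy-Schwarz applied to each row of \<open>A\<close>.\<close>

lemma norm_mult_vec_le_frobenius: "norm (A *v v) \<le> frobenius_norm A * norm v"
proof -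
  have "(norm (A *v v))\<^sup>2 = (\<Sum>i\<in>UNIV. (cmod (tdot (A $ i) v))\<^sup>2)"
    by (simp add: norm_vec_def L2_set_def sum_nonneg matrix_vector_mult_def tdot_def)
  also have "\<dots> \<le> (\<Sum>i\<in>UNIV. (norm (A $ i) * norm v)\<^sup>2)"
    by (intro sum_mono power_mono norm_tdot_le norm_ge_zero)
  also have "\<dots> = (\<Sum>i\<in>UNIV. (norm (A $ i))\<^sup>2) * (norm v)\<^sup>2"
    by (simp add: power_mult_distrib sum_distrib_right)
  also have "(\<Sum>i\<in>UNIV. (norm (A $ i))\<^sup>2) = (frobenius_norm A)\<^sup>2"
    by (simp add: frobenius_norm_eq_norm norm_vec_def [of A] L2_set_def sum_nonneg)
  finally have "(norm (A *v v))\<^sup>2 \<le> (frobenius_norm A * norm v)\<^sup>2"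
    by (simp add: power_mult_distrib)
  then show ?thesis
    by (rule power2_le_imp_le) (simp add: frobenius_norm_eq_norm)
qed

lemma spectral_le_frobenius: "spectral_norm A \<le> frobenius_norm A"
  unfolding spectral_norm_def
  by (rule onorm_bound) (simp_all add: norm_mult_vec_le_frobenius, simp add: frobenius_norm_eq_norm)

section \<open>Evaluation and T-evenness in terms of coefficients\<close>

lemma coeff_mp_of [simp]: "coeff (mp_of m A) j = (if j \<le> m then A j else 0)"
  by (auto simp: mp_of_def coeff_sum sum.delta' if_distrib [of "\<lambda>c. c = _"] cong: if_cong)

lemma mp_of_in_matpolys: "mp_of m A \<in> matpolys m"
  unfolding matpolys_def by (auto intro: degree_le)

lemma mpeval_matpolys:
  assumes "Q \<in> matpolys m"
  shows "mpeval Q z = (\<Sum>j\<le>m. z ^ j *\<^sub>m coeff Q j)"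
  unfolding mpeval_def
  by (rule sum.mono_neutral_left)
    (use assms in \<open>auto simp: matpolys_def mscale_simps coeff_eq_0\<close>)

lemma sum_mult_vec: "sum A S *v v = (\<Sum>j\<in>S. A j *v (v :: complex ^ 'n))"
  by (induction S rule: infinite_finite_induct)
    (auto simp: matrix_vector_mult_add_rdistrib)

lemma mpeval_mult_vec:
  assumes "Q \<in> matpolys m"
  shows "mpeval Q z *v v = (\<Sum>j\<le>m. z ^ j *s (coeff Q j *v v))"
  by (simp add: mpeval_matpolys [OF assms] sum_mult_vec)

text \<open>Entry by entry, the condition equates two polynomial functions of degree at most
  \<open>m\<close> for all \<open>z\<close>, so their coefficients agree.\<close>

lemma T_even_iff:
  "Q \<in> T_even m \<longleftrightarrow> Q \<in> matpolys m \<and> (\<forall>j\<le>m. transpose (coeff Q j) = (-1) ^ j *\<^sub>m coeff Q j)"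
proof (cases "Q \<in> matpolys m")
  case True
  have eq: "(\<forall>z. (\<Sum>j\<le>m. coeff Q j $ k $ i * z ^ j) = (\<Sum>j\<le>m. ((-1) ^ j * coeff Q j $ i $ k) * z ^ j))
     \<longleftrightarrow> (\<forall>j\<le>m. coeff Q j $ k $ i = (-1) ^ j * coeff Q j $ i $ k)" for i k
    by (rule polyfun_eq_coeffs)
  have "transpose (mpeval Q z) = mpeval Q (- z) \<longleftrightarrow>
     (\<forall>i k. (\<Sum>j\<le>m. coeff Q j $ k $ i * z ^ j) = (\<Sum>j\<le>m. ((-1) ^ j * coeff Q j $ i $ k) * z ^ j))"
    for z
    by (simp add: mpeval_matpolys [OF True] vec_eq_iff transpose_def mscale_def map_matrix_def
        power_minus [of z] mult_ac)
  then have "Q \<in> T_even m \<longleftrightarrow>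
     (\<forall>z i k. (\<Sum>j\<le>m. coeff Q j $ k $ i * z ^ j) = (\<Sum>j\<le>m. ((-1) ^ j * coeff Q j $ i $ k) * z ^ j))"
    using True by (simp add: T_even_def)
  also have "\<dots> \<longleftrightarrow> (\<forall>i k. \<forall>j\<le>m. coeff Q j $ k $ i = (-1) ^ j * coeff Q j $ i $ k)"
    by (simp only: eq [symmetric]) blast
  also have "\<dots> \<longleftrightarrow> (\<forall>j\<le>m. transpose (coeff Q j) = (-1) ^ j *\<^sub>m coeff Q j)"
    by (auto simp: vec_eq_iff transpose_def mscale_def map_matrix_def)
  finally show ?thesis using True by simp
qed (simp add: T_even_def)

lemma T_even_matpolys: "Q \<in> T_even m \<Longrightarrow> Q \<in> matpolys m"
  by (simp add: T_even_def)

lemma uminus_matrix_vector_mult: "(- A) *v v = - (A *v (v :: complex ^ 'n))"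
  by (simp add: matrix_vector_mult_def vec_eq_iff sum_negf)

text \<open>The scalar is its own transpose, hence its own negative. This is why only even indices
  can contribute to \<open>tdot x r\<close>, and why \<open>Pi_e\<close> enters the
  formulas.\<close>

lemma tdot_skew_eq_0:
  assumes "transpose A = (-1) ^ j *\<^sub>m A" "odd j"
  shows "tdot x (A *v x) = (0 :: complex)"
  using tdot_transpose [of x A x] assms by (simp add: mscale_simps uminus_matrix_vector_mult)

lemma norm2_Lam: "(norm2 m (Lam lam))\<^sup>2 = (\<Sum>j\<le>m. (cmod (lam ^ j))\<^sup>2)"
  by (simp add: norm2_def Lam_def L2_set_def sum_nonneg)

lemma norm2_Pi_e:
  "(norm2 m (Pi_e (Lam lam)))\<^sup>2 = (\<Sum>j\<le>m. if even j then (cmod (lam ^ j))\<^sup>2 else 0)"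
  by (auto simp: norm2_def Lam_def Pi_e_def L2_set_def sum_nonneg intro!: sum.cong)

text \<open>Index 0 contributes \<open>lam ^ 0 = 1\<close> even for \<open>lam = 0\<close>; being
  even, it also keeps the projected sum positive.\<close>

lemma norm2_Lam_pos: "0 < (norm2 m (Lam lam))\<^sup>2"
  unfolding norm2_Lam by (rule sum_pos2 [of _ 0]) auto

lemma norm2_Pi_e_pos: "0 < (norm2 m (Pi_e (Lam lam)))\<^sup>2"
  unfolding norm2_Pi_e by (rule sum_pos2 [of _ 0]) auto

text \<open>A feasible \<open>D\<close> reaching the lower bound turns the infimum into a minimum,
  so one witness gives both the backward error and its attainment.\<close>

lemma backward_error_eqI:
  assumes "D \<in> S" "mpeval P lam *v x + mpeval D lam *v x = 0"
    and "\<And>Q. Q \<in> S \<Longrightarrow> mpeval P lam *v x + mpeval Q lam *v x = 0 \<Longrightarrow> b \<le> mpnorm N m Q"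
    and "mpnorm N m D \<le> b"
  shows "backward_error N m S lam x P = b" "mpnorm N m D = b"
proof -
  show eq: "mpnorm N m D = b" using assms by (intro antisym) auto
  show "backward_error N m S lam x P = b"
    unfolding backward_error_def
    by (rule cInf_eq_minimum) (use assms eq in auto)
qed

text \<open>Pythagoras: the hypothesis says that the family \<open>g - f\<close> is orthogonal to
  \<open>f\<close>. The last sum measures the distance to the minimiser.\<close>

lemma sum_norm_projection:
  fixes f g :: "'i \<Rightarrow> 'a::real_inner"
  assumes "(\<Sum>j\<in>A. f j \<bullet> g j) = (\<Sum>j\<in>A. f j \<bullet> f j)"
  shows "(\<Sum>j\<in>A. (norm (g j))\<^sup>2) = (\<Sum>j\<in>A. (norm (f j))\<^sup>2) + (\<Sum>j\<in>A. (norm (g j - f j))\<^sup>2)"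
proof -
  have "(norm (g j))\<^sup>2 = (norm (f j))\<^sup>2 + (norm (g j - f j))\<^sup>2 + 2 * (f j \<bullet> g j - f j \<bullet> f j)" for j
    by (simp add: power2_norm_eq_inner inner_diff_left inner_diff_right inner_commute)
  then show ?thesis
    using assms by (simp add: sum.distrib sum_subtractf flip: sum_distrib_left)
qed


section \<open>The minimal perturbations\<close>

locale unit_vector_residual =
  fixes m :: nat and lam :: complex and x r :: "complex ^ 'n::finite"
  assumes unit: "tdot (conjv x) x = 1"
begin

section \<open>Splitting the residual along the conjugate of \<open>x\<close>\<close>

definition xr :: complex where "xr = tdot x r"

definition s :: "complex ^ 'n" where "s = r - xr *s conjv x"

abbreviation L2 :: real where "L2 \<equiv> (norm2 m (Lam lam))\<^sup>2"

abbreviation P2 :: real where "P2 \<equiv> (norm2 m (Pi_e (Lam lam)))\<^sup>2"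

text \<open>Up to \<open>cnj (lam ^ j)\<close>, the component of \<open>E j *v x\<close> along
  \<open>conjv x\<close>; skew-symmetry forces it to vanish for odd \<open>j\<close>.\<close>

definition mu :: "nat \<Rightarrow> complex" where "mu j = (if even j then xr / of_real P2 else 0)"

abbreviation E :: "nat \<Rightarrow> complex ^ 'n ^ 'n" where "E \<equiv> E_coeff m lam x r"

abbreviation DA :: "nat \<Rightarrow> complex ^ 'n ^ 'n" where "DA \<equiv> DA_coeff m lam x r"

text \<open>Feasibility is phrased for coefficient families, so that the estimates avoid
  polynomials; \<open>T_even_iff\<close> and \<open>solves_iff_mpeval\<close> translate.\<close>

definition solves :: "(nat \<Rightarrow> complex ^ 'n ^ 'n) \<Rightarrow> bool"
  where "solves A \<longleftrightarrow> (\<Sum>j\<le>m. lam ^ j *s (A j *v x)) = r"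

definition alternating :: "(nat \<Rightarrow> complex ^ 'n ^ 'n) \<Rightarrow> bool"
  where "alternating A \<longleftrightarrow> (\<forall>j\<le>m. transpose (A j) = (-1) ^ j *\<^sub>m A j)"

lemma L2_pos: "0 < L2" and P2_pos: "0 < P2"
  by (rule norm2_Lam_pos norm2_Pi_e_pos)+

lemma unit' [simp]: "tdot (conjv x) x = 1" "tdot x (conjv x) = 1"
  using unit by (simp_all add: tdot_commute)

lemma norm_x [simp]: "norm x = 1"
proof -
  have "complex_of_real ((norm x)\<^sup>2) = 1"
    using unit by (simp only: tdot_conjv_self)
  then show ?thesis
    by (simp only: of_real_eq_1_iff power2_eq_1_iff) (use norm_ge_zero [of x] in linarith)
qed

lemma tdot_x_s [simp]: "tdot x s = 0" "tdot s x = 0"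
  by (simp_all add: s_def xr_def tdot_commute [of _ x])

lemma tdot_conj_s [simp]: "tdot (conjv x) (conjv s) = 0" "tdot (conjv s) (conjv x) = 0"
  by (simp_all flip: cnj_tdot)

lemma tdot_s_conj_s [simp]:
  "tdot (conjv s) s = of_real ((norm s)\<^sup>2)" "tdot s (conjv s) = of_real ((norm s)\<^sup>2)"
  using tdot_conjv_self [of s] by (simp_all add: tdot_commute [of s])

lemma r_decomp: "r = xr *s conjv x + s"
  by (simp add: s_def)

text \<open>Pythagoras for the orthogonal summands of \<open>r\<close>; it is the source of the
  numerator \<open>(norm r)^2 - |tdot x r|^2\<close>.\<close>

lemma norm_s: "(norm s)\<^sup>2 = (norm r)\<^sup>2 - (cmod xr)\<^sup>2"
  using norm_add_orthogonal [of "conjv x" s xr 1] by (simp flip: r_decomp)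

lemma norm_conjx_s: "(norm (c *s conjv x + d *s s))\<^sup>2 = (cmod c)\<^sup>2 + (cmod d)\<^sup>2 * (norm s)\<^sup>2"
  by (simp add: norm_add_orthogonal)

lemma s_eq_0_iff: "s = 0 \<longleftrightarrow> cmod xr = norm r"
proof -
  have "s = 0 \<longleftrightarrow> (norm s)\<^sup>2 = 0" by simp
  also have "\<dots> \<longleftrightarrow> (cmod xr)\<^sup>2 = (norm r)\<^sup>2"
    unfolding norm_s by auto
  also have "\<dots> \<longleftrightarrow> cmod xr = norm r"
    by (simp add: power2_eq_iff_nonneg)
  finally show ?thesis .
qed

text \<open>Both parities in one formula: \<open>mu\<close> switches off the first term for odd
  \<open>j\<close>, and the sign makes the rest symmetric or skew-symmetric.\<close>

lemma E_alt: "E j = (cnj (lam ^ j) * mu j) *\<^sub>m outer (conjv x) (conjv x)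
    + (cnj (lam ^ j) / of_real L2) *\<^sub>m (outer s (conjv x) + (-1) ^ j *\<^sub>m outer (conjv x) s)"
  by (simp add: E_coeff_def matrix_mult_outer outer_matrix_mult vector_mult_proj_perp mu_def
      mscale_simps add_ac flip: s_def xr_def)

text \<open>The exceptional case of \<open>DA_coeff\<close> is \<open>s = 0\<close>, where the correction vanishes anyway.\<close>

lemma DA_alt: "DA j = E j -
    (cnj (lam ^ j) * (if even j then cnj xr / of_real (P2 * (norm s)\<^sup>2) else 0)) *\<^sub>m outer s s"
  by (auto simp: DA_coeff_def matrix_mult_outer outer_matrix_mult vector_mult_proj_perp
      mscale_simps s_eq_0_iff [symmetric] norm_s [symmetric]
      simp flip: s_def xr_def simp del: of_real_diff of_real_power)

lemma E_mult: "E j *v v = cnj (lam ^ j) *s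
    ((mu j * tdot (conjv x) v + (-1) ^ j * tdot s v / of_real L2) *s conjv x
      + (tdot (conjv x) v / of_real L2) *s s)"
  by (simp add: E_alt matrix_vector_mult_add_rdistrib vec_eq_iff algebra_simps)

lemma E_mult_x: "E j *v x = cnj (lam ^ j) *s (mu j *s conjv x + (1 / of_real L2) *s s)"
  by (simp add: E_mult)

lemma DA_mult: "DA j *v v = cnj (lam ^ j) *s
    ((mu j * tdot (conjv x) v + (-1) ^ j * tdot s v / of_real L2) *s conjv x
      + (tdot (conjv x) v / of_real L2
          - (if even j then cnj xr / of_real (P2 * (norm s)\<^sup>2) else 0) * tdot s v) *s s)"
  by (simp add: DA_alt matrix_vector_mult_diff_rdistrib E_mult vec_eq_iff algebra_simps)

section \<open>Admissibility of the families \<open>E\<close> and \<open>DA\<close>\<close>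

lemma alternating_E: "alternating E"
  by (auto simp: alternating_def E_alt transpose_add transpose_diff mscale_simps mu_def algebra_simps
      uminus_matrix_vector_mult)

lemma alternating_DA: "alternating DA"
  using alternating_E
  by (auto simp: alternating_def DA_alt transpose_diff mscale_simps)

lemma sum_weights:
  "(\<Sum>j\<le>m. lam ^ j * cnj (lam ^ j)) = of_real L2"
  "(\<Sum>j\<le>m. lam ^ j * (cnj (lam ^ j) * mu j)) = xr"
proof -
  have w: "z * cnj z = of_real ((cmod z)\<^sup>2)" for z
    by (rule complex_norm_square [symmetric])
  show "(\<Sum>j\<le>m. lam ^ j * cnj (lam ^ j)) = of_real L2"
    by (simp only: norm2_Lam w of_real_sum)
  have "(\<Sum>j\<le>m. lam ^ j * (cnj (lam ^ j) * mu j))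
      = (\<Sum>j\<le>m. of_real (if even j then (cmod (lam ^ j))\<^sup>2 else 0) * (xr / of_real P2))"
    by (rule sum.cong) (simp_all only: mult.assoc [symmetric] w, simp_all add: mu_def)
  also have "\<dots> = of_real P2 * (xr / of_real P2)"
    by (simp only: norm2_Pi_e sum_distrib_right [symmetric] of_real_sum)
  also have "\<dots> = xr"
    using P2_pos by simp
  finally show "(\<Sum>j\<le>m. lam ^ j * (cnj (lam ^ j) * mu j)) = xr" .
qed

lemma solves_E: "solves E"
proof -
  have "(\<Sum>j\<le>m. lam ^ j *s (E j *v x))
      = (\<Sum>j\<le>m. lam ^ j * (cnj (lam ^ j) * mu j)) *s conjv x
        + ((\<Sum>j\<le>m. lam ^ j * cnj (lam ^ j)) / of_real L2) *s s"
    by (simp add: E_mult_x vec_eq_iff sum.distrib sum_distrib_left sum_divide_distrib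
        algebra_simps)
  also have "\<dots> = r"
    unfolding sum_weights using L2_pos by (simp add: r_decomp [symmetric])
  finally show ?thesis by (simp add: solves_def)
qed

text \<open>The correction is a multiple of \<open>outer s s\<close>, which annihilates
  \<open>x\<close> because \<open>tdot s x = 0\<close>.\<close>

lemma DA_mult_x: "DA j *v x = E j *v x"
  by (simp add: DA_mult E_mult_x)

lemma solves_DA: "solves DA"
  using solves_E by (simp add: solves_def DA_mult_x)

lemma inner_E:
  assumes "alternating A" "solves A"
  shows "(\<Sum>j\<le>m. E j \<bullet> A j) = (cmod xr)\<^sup>2 / P2 + 2 * ((norm s)\<^sup>2 / L2)"
proof -
  \<comment> \<open>The factor 2 arises because the two rank-one terms of \<open>E j\<close>
    containing \<open>s\<close> contribute equally.\<close>
  define w where "w = (cnj xr / of_real P2) *s x + (2 / of_real L2) *s conjv s"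
  have "E j \<bullet> A j = Re (tdot w (lam ^ j *s (A j *v x)))" if "j \<le> m" for j
  proof -
    have tr: "transpose (A j) = (-1) ^ j *\<^sub>m A j"
      using assms(1) that by (simp add: alternating_def)
    \<comment> \<open>Transposition produces a sign that cancels the \<open>(-1) ^ j\<close> in
      \<open>E_alt\<close>.\<close>
    have sw: "tdot x (A j *v conjv s) = (-1) ^ j * tdot (conjv s) (A j *v x)"
      using tdot_transpose [of "conjv s" "A j" x] by (simp add: tr)
    have "E j \<bullet> A j = ((cnj (lam ^ j) * mu j) *\<^sub>m outer (conjv x) (conjv x)) \<bullet> A j
       + ((cnj (lam ^ j) / of_real L2) *\<^sub>m outer s (conjv x)) \<bullet> A j
       + ((cnj (lam ^ j) / of_real L2 * (-1) ^ j) *\<^sub>m outer (conjv x) s) \<bullet> A j"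
      by (simp add: E_alt mscale_simps inner_add_left)
    also have "\<dots> = Re (lam ^ j * (cnj (mu j) * tdot x (A j *v x)
        + 2 / of_real L2 * tdot (conjv s) (A j *v x)))"
      unfolding inner_mscale_outer plus_complex.sel [symmetric]
      by (rule arg_cong [of _ _ Re]) (simp add: sw field_simps)
    \<comment> \<open>For odd \<open>j\<close> the form vanishes, so \<open>mu j\<close> may be
      replaced by a constant. Then \<open>w\<close> does not depend on \<open>j\<close>, and the sum
      over \<open>j\<close> collapses to \<open>tdot w r\<close>.\<close>
    also have "cnj (mu j) * tdot x (A j *v x) = cnj xr / of_real P2 * tdot x (A j *v x)"
      using tdot_skew_eq_0 [OF tr] by (auto simp: mu_def)
    finally show ?thesis
      by (simp add: w_def algebra_simps)
  qed
  then have "(\<Sum>j\<le>m. E j \<bullet> A j) = Re (tdot w (\<Sum>j\<le>m. lam ^ j *s (A j *v x)))"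
    by (simp add: tdot_sum)
  also have "\<dots> = Re (tdot w r)"
    using assms(2) by (simp add: solves_def)
  also have "tdot w r = of_real ((cmod xr)\<^sup>2 / P2 + 2 * ((norm s)\<^sup>2 / L2))"
    by (subst r_decomp) (simp add: w_def complex_norm_square algebra_simps del: of_real_power)
  finally show ?thesis by (simp only: Re_complex_of_real)
qed

text \<open>The same collapse as in \<open>inner_E\<close>, without the factor 2, since
  \<open>s\<close> enters \<open>E j *v x\<close> through one term only.\<close>

lemma inner_E_x:
  assumes "alternating A" "solves A"
  shows "(\<Sum>j\<le>m. (E j *v x) \<bullet> (A j *v x)) = (cmod xr)\<^sup>2 / P2 + (norm s)\<^sup>2 / L2"
proof -
  define w where "w = (cnj xr / of_real P2) *s x + (1 / of_real L2) *s conjv s"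
  have "(E j *v x) \<bullet> (A j *v x) = Re (tdot w (lam ^ j *s (A j *v x)))" if "j \<le> m" for j
  proof -
    have tr: "transpose (A j) = (-1) ^ j *\<^sub>m A j"
      using assms(1) that by (simp add: alternating_def)
    have "conjv (E j *v x) = (lam ^ j * cnj (mu j)) *s x + (lam ^ j / of_real L2) *s conjv s"
      by (simp add: E_mult_x vec_eq_iff algebra_simps)
    then have "(E j *v x) \<bullet> (A j *v x) = Re (lam ^ j * (cnj (mu j) * tdot x (A j *v x)
        + 1 / of_real L2 * tdot (conjv s) (A j *v x)))"
      unfolding inner_tdot by (intro arg_cong [of _ _ Re]) (simp add: algebra_simps)
    also have "cnj (mu j) * tdot x (A j *v x) = cnj xr / of_real P2 * tdot x (A j *v x)"
      using tdot_skew_eq_0 [OF tr] by (auto simp: mu_def)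
    finally show ?thesis
      by (simp add: w_def algebra_simps)
  qed
  then have "(\<Sum>j\<le>m. (E j *v x) \<bullet> (A j *v x)) = Re (tdot w (\<Sum>j\<le>m. lam ^ j *s (A j *v x)))"
    by (simp add: tdot_sum)
  also have "\<dots> = Re (tdot w r)"
    using assms(2) by (simp add: solves_def)
  also have "tdot w r = of_real ((cmod xr)\<^sup>2 / P2 + (norm s)\<^sup>2 / L2)"
    by (subst r_decomp) (simp add: w_def complex_norm_square algebra_simps del: of_real_power)
  finally show ?thesis by (simp only: Re_complex_of_real)
qed

section \<open>Minimal values and lower bounds\<close>

lemma sum_norm_E: "(\<Sum>j\<le>m. (norm (E j))\<^sup>2) = (cmod xr)\<^sup>2 / P2 + 2 * ((norm s)\<^sup>2 / L2)"
  using inner_E [OF alternating_E solves_E] by (simp add: power2_norm_eq_inner)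

lemma sum_norm_E_x: "(\<Sum>j\<le>m. (norm (E j *v x))\<^sup>2) = (cmod xr)\<^sup>2 / P2 + (norm s)\<^sup>2 / L2"
  using inner_E_x [OF alternating_E solves_E] by (simp add: power2_norm_eq_inner)

text \<open>An equality rather than a bound: its last sum yields uniqueness.\<close>

lemma frobenius_projection:
  assumes "alternating A" "solves A"
  shows "(\<Sum>j\<le>m. (norm (A j))\<^sup>2)
    = (cmod xr)\<^sup>2 / P2 + 2 * ((norm s)\<^sup>2 / L2) + (\<Sum>j\<le>m. (norm (A j - E j))\<^sup>2)"
  using sum_norm_projection [of E A "{..m}"]
  by (simp add: inner_E alternating_E solves_E assms sum_norm_E)

text \<open>As \<open>x\<close> is a unit vector, each spectral norm dominates
  \<open>norm (A j *v x)\<close>, and these vectors are bounded by projection.\<close>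

lemma spectral_lower_bound:
  assumes "alternating A" "solves A"
  shows "(cmod xr)\<^sup>2 / P2 + (norm s)\<^sup>2 / L2 \<le> (\<Sum>j\<le>m. (spectral_norm (A j))\<^sup>2)"
proof -
  have "(cmod xr)\<^sup>2 / P2 + (norm s)\<^sup>2 / L2 \<le> (\<Sum>j\<le>m. (norm (A j *v x))\<^sup>2)"
    using sum_norm_projection [of "\<lambda>j. E j *v x" "\<lambda>j. A j *v x" "{..m}"]
    by (simp add: inner_E_x alternating_E solves_E assms sum_norm_E_x sum_nonneg)
  also have "\<dots> \<le> (\<Sum>j\<le>m. (spectral_norm (A j))\<^sup>2)"
    using norm_mult_vec_le_spectral [of "A _" x] by (intro sum_mono power_mono) simp_all
  finally show ?thesis .
qed

section \<open>Spectral bound for the completed coefficients\<close>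

lemma bessel_x_conj_s:
  "(cmod (tdot s v))\<^sup>2 \<le> (norm s)\<^sup>2 * ((norm v)\<^sup>2 - (cmod (tdot (conjv x) v))\<^sup>2)"
proof -
  \<comment> \<open>Removing the \<open>x\<close> component leaves \<open>tdot s v\<close>
    unchanged; Cauchy-Schwarz on the remainder then gives Bessel's inequality for \<open>x\<close>
    and \<open>conjv s\<close>, in a form valid for \<open>s = 0\<close>.\<close>
  define w where "w = v - tdot (conjv x) v *s x"
  have "tdot (conjv x) w = 0"
    by (simp add: w_def)
  then have "(norm (tdot (conjv x) v *s x + 1 *s w))\<^sup>2
      = (cmod (tdot (conjv x) v))\<^sup>2 * (norm x)\<^sup>2 + (cmod 1)\<^sup>2 * (norm w)\<^sup>2"
    by (rule norm_add_orthogonal)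
  then have "(norm w)\<^sup>2 = (norm v)\<^sup>2 - (cmod (tdot (conjv x) v))\<^sup>2"
    by (simp add: w_def)
  moreover have "cmod (tdot s w) \<le> norm s * norm w"
    by (rule norm_tdot_le)
  then have "(cmod (tdot s w))\<^sup>2 \<le> (norm s * norm w)\<^sup>2"
    by (rule power_mono) simp
  moreover have "tdot s w = tdot s v"
    by (simp add: w_def)
  ultimately show ?thesis
    by (simp add: power_mult_distrib)
qed

text \<open>In the orthogonal directions \<open>conjv x\<close> and \<open>s\<close> the image has a
  squared norm free of cross terms, so Bessel's inequality bounds it by the value at
  \<open>v = x\<close>.\<close>

lemma norm_DA_mult_le:
  "(norm (DA j *v v))\<^sup>2 \<le> (norm (E j *v x))\<^sup>2 * (norm v)\<^sup>2"
proof -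
  \<comment> \<open>The weight of the correction; division by zero makes it 0 when
    \<open>s = 0\<close>.\<close>
  define nu where "nu = (if even j then cnj xr / of_real (P2 * (norm s)\<^sup>2) else 0)"
  define S l where "S = (norm s)\<^sup>2" and "l = L2"
  define xi sg where "xi = tdot (conjv x) v" and "sg = tdot s v"
  define q where "q = (mu j * xi + (-1) ^ j * sg / of_real l)"
  have l: "l > 0" and S: "S \<ge> 0" using L2_pos by (simp_all add: l_def S_def)
  have b: "(cmod sg)\<^sup>2 \<le> S * ((norm v)\<^sup>2 - (cmod xi)\<^sup>2)"
    unfolding S_def sg_def xi_def by (rule bessel_x_conj_s)
  have nuS: "nu * of_real S = cnj (mu j)" if "S \<noteq> 0"
    using that by (simp add: nu_def mu_def S_def)
  have nonneg: "0 \<le> (norm v)\<^sup>2 - (cmod xi)\<^sup>2"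
    using norm_tdot_le [of "conjv x" v] by (simp add: xi_def power_mono)
  \<comment> \<open>The cross terms cancel by \<open>nuS\<close>, which is what determines the
    correction. For odd \<open>j\<close> both \<open>mu j\<close> and \<open>nu\<close> vanish, and
    for \<open>S = 0\<close> so does \<open>sg\<close>.\<close>
  have "(cmod q)\<^sup>2 + (cmod (xi / of_real l - nu * sg))\<^sup>2 * S
      = ((cmod (mu j))\<^sup>2 + (1 / l)\<^sup>2 * S) * (cmod xi)\<^sup>2 + ((1 / l)\<^sup>2 + (cmod nu)\<^sup>2 * S) * (cmod sg)\<^sup>2"
  proof (cases "S = 0")
    case True
    then have "sg = 0" using b by simp
    with True show ?thesis by (simp add: q_def norm_mult power_mult_distrib)
  next
    case False
    show ?thesis
    proof (cases "even j")
      case True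
      have cross: "Re (mu j * xi * cnj sg) = S * Re (xi * cnj nu * cnj sg)"
      proof -
        have "mu j = cnj nu * of_real S" using nuS [OF False] by (simp add: complex_eq_iff)
        then have "mu j * xi * cnj sg = of_real S * (xi * cnj nu * cnj sg)" by simp
        moreover have "Re (of_real S * z) = S * Re z" for z by simp
        ultimately show ?thesis by (simp only:)
      qed
      have sq: "(cmod (u + v))\<^sup>2 = (cmod u)\<^sup>2 + (cmod v)\<^sup>2 + 2 * Re (u * cnj v)" for u v
        unfolding cmod_power2 by (simp add: power2_eq_square algebra_simps)
      have sq': "(cmod (u - v))\<^sup>2 = (cmod u)\<^sup>2 + (cmod v)\<^sup>2 - 2 * Re (u * cnj v)" for u v
        unfolding cmod_power2 by (simp add: power2_eq_square algebra_simps)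
      have "mu j * xi * cnj (sg / of_real l) = mu j * xi * cnj sg / of_real l"
        "xi / of_real l * cnj (nu * sg) = xi * cnj nu * cnj sg / of_real l"
        by simp_all
      then have "(cmod (mu j * xi + sg / of_real l))\<^sup>2
          = (cmod (mu j * xi))\<^sup>2 + (cmod (sg / of_real l))\<^sup>2 + 2 * (Re (mu j * xi * cnj sg) / l)"
        "(cmod (xi / of_real l - nu * sg))\<^sup>2
          = (cmod (xi / of_real l))\<^sup>2 + (cmod (nu * sg))\<^sup>2 - 2 * (Re (xi * cnj nu * cnj sg) / l)"
        by (simp_all only: sq sq' Re_divide_of_real)
      moreover have "q = mu j * xi + sg / of_real l"
        using True by (simp add: q_def)
      ultimately show ?thesis
        unfolding cross by (simp only:) (simp add: norm_mult norm_divide power_mult_distrib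
            power_divide algebra_simps del: times_complex.sel)
    next
      case False
      then show ?thesis
        by (simp add: q_def mu_def nu_def norm_mult norm_divide power_mult_distrib power_divide
            field_simps)
    qed
  qed
  also have "((1 / l)\<^sup>2 + (cmod nu)\<^sup>2 * S) * (cmod sg)\<^sup>2
      \<le> ((1 / l)\<^sup>2 + (cmod nu)\<^sup>2 * S) * (S * ((norm v)\<^sup>2 - (cmod xi)\<^sup>2))"
    using b S by (intro mult_left_mono) auto
  \<comment> \<open>Equality if \<open>S\<close> is nonzero, since then
    \<open>|nu| * S = |mu j|\<close>. For \<open>S = 0\<close> the left side is 0 while
    \<open>mu j\<close> may be nonzero.\<close>
  also have "((1 / l)\<^sup>2 + (cmod nu)\<^sup>2 * S) * (S * ((norm v)\<^sup>2 - (cmod xi)\<^sup>2))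
      \<le> ((cmod (mu j))\<^sup>2 + (1 / l)\<^sup>2 * S) * ((norm v)\<^sup>2 - (cmod xi)\<^sup>2)"
  proof -
    have "((cmod nu) * S)\<^sup>2 \<le> (cmod (mu j))\<^sup>2"
    proof (cases "S = 0")
      case False
      have "cmod (nu * of_real S) = cmod (mu j)"
        using nuS [OF False] by simp
      then show ?thesis using S by (simp add: norm_mult)
    qed simp
    then have "((1 / l)\<^sup>2 + (cmod nu)\<^sup>2 * S) * S \<le> (cmod (mu j))\<^sup>2 + (1 / l)\<^sup>2 * S"
      by (simp add: power2_eq_square algebra_simps)
    from mult_right_mono [OF this nonneg] show ?thesis
      by (simp add: mult.assoc)
  qed
  finally have "(cmod q)\<^sup>2 + (cmod (xi / of_real l - nu * sg))\<^sup>2 * S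
      \<le> ((cmod (mu j))\<^sup>2 + (1 / l)\<^sup>2 * S) * (norm v)\<^sup>2"
    by (simp add: algebra_simps)
  then have "(cmod (lam ^ j))\<^sup>2 * ((cmod q)\<^sup>2 + (cmod (xi / of_real l - nu * sg))\<^sup>2 * S)
      \<le> (cmod (lam ^ j))\<^sup>2 * (((cmod (mu j))\<^sup>2 + (1 / l)\<^sup>2 * S) * (norm v)\<^sup>2)"
    by (rule mult_left_mono) simp
  moreover have "(norm (DA j *v v))\<^sup>2
      = (cmod (lam ^ j))\<^sup>2 * ((cmod q)\<^sup>2 + (cmod (xi / of_real l - nu * sg))\<^sup>2 * S)"
    unfolding DA_mult norm_vector_scalar_mult power_mult_distrib norm_conjx_s complex_mod_cnj
    by (simp only: q_def xi_def sg_def l_def nu_def S_def)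
  moreover have "(norm (E j *v x))\<^sup>2 = (cmod (lam ^ j))\<^sup>2 * ((cmod (mu j))\<^sup>2 + (1 / l)\<^sup>2 * S)"
    unfolding E_mult_x norm_vector_scalar_mult power_mult_distrib norm_conjx_s complex_mod_cnj
    using l by (simp add: l_def S_def norm_divide del: of_real_power)
  ultimately show ?thesis
    by (simp add: mult.assoc)
qed

lemma spectral_DA: "(\<Sum>j\<le>m. (spectral_norm (DA j))\<^sup>2) \<le> (cmod xr)\<^sup>2 / P2 + (norm s)\<^sup>2 / L2"
proof -
  have "(spectral_norm (DA j))\<^sup>2 \<le> (norm (E j *v x))\<^sup>2" for j
    by (rule spectral_norm_le [OF _ norm_DA_mult_le]) simp
  then show ?thesis
    unfolding sum_norm_E_x [symmetric] by (intro sum_mono) auto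
qed

text \<open>The unstructured optimum is attained by rank-one coefficients, for which both norms agree.\<close>

definition U :: "nat \<Rightarrow> complex ^ 'n ^ 'n"
  where "U j = (cnj (lam ^ j) / of_real L2) *\<^sub>m outer r (conjv x)"

lemma U_mult: "U j *v v = (cnj (lam ^ j) / of_real L2 * tdot (conjv x) v) *s r"
  by (simp add: U_def vec_eq_iff)

lemma solves_U: "solves U"
proof -
  have "(\<Sum>j\<le>m. lam ^ j *s (U j *v x)) = ((\<Sum>j\<le>m. lam ^ j * cnj (lam ^ j)) / of_real L2) *s r"
    by (simp add: U_mult vec_eq_iff sum_distrib_right sum_divide_distrib)
  also have "\<dots> = r"
    unfolding sum_weights using L2_pos by simp
  finally show ?thesis by (simp add: solves_def)
qed

lemma inner_U_x:
  assumes "solves A"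
  shows "(\<Sum>j\<le>m. (U j *v x) \<bullet> (A j *v x)) = (norm r)\<^sup>2 / L2"
proof -
  have "conjv (U j *v x) = (lam ^ j / of_real L2) *s conjv r" for j
    by (simp add: U_mult)
  then have "(U j *v x) \<bullet> (A j *v x)
      = Re (tdot ((1 / of_real L2) *s conjv r) (lam ^ j *s (A j *v x)))" for j
    unfolding inner_tdot by (intro arg_cong [of _ _ Re]) (simp add: algebra_simps)
  then have "(\<Sum>j\<le>m. (U j *v x) \<bullet> (A j *v x))
      = Re (tdot ((1 / of_real L2) *s conjv r) (\<Sum>j\<le>m. lam ^ j *s (A j *v x)))"
    by (simp add: tdot_sum)
  also have "\<dots> = Re (of_real ((norm r)\<^sup>2 / L2))"
    using assms by (simp add: solves_def tdot_conjv_self)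
  finally show ?thesis by (simp only: Re_complex_of_real)
qed

text \<open>Stated for \<open>A j *v x\<close>, so that it serves every matrix norm dominating the
  action on \<open>x\<close>.\<close>

lemma unstructured_lower_bound:
  assumes "solves A"
  shows "(norm r)\<^sup>2 / L2 \<le> (\<Sum>j\<le>m. (norm (A j *v x))\<^sup>2)"
proof -
  have "(\<Sum>j\<le>m. (U j *v x) \<bullet> (U j *v x)) = (norm r)\<^sup>2 / L2"
    by (rule inner_U_x [OF solves_U])
  with sum_norm_projection [of "\<lambda>j. U j *v x" "\<lambda>j. A j *v x" "{..m}"]
  show ?thesis
    by (simp add: inner_U_x assms power2_norm_eq_inner [symmetric] sum_nonneg)
qed

text \<open>\<open>U j\<close> has rank one with a unit right factor, so its Frobenius norm is
  \<open>norm (U j *v x)\<close>.\<close>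

lemma frobenius_U: "(\<Sum>j\<le>m. (frobenius_norm (U j))\<^sup>2) = (norm r)\<^sup>2 / L2"
proof -
  have "U j \<bullet> U j = (U j *v x) \<bullet> (U j *v x)" for j
    using inner_mscale_outer [of "cnj (lam ^ j) / of_real L2" r "conjv x" "U j"]
    unfolding U_def [symmetric] by (simp add: inner_tdot U_mult mult_ac del: times_complex.sel)
  then show ?thesis
    using inner_U_x [OF solves_U] by (simp add: frobenius_norm_eq_norm power2_norm_eq_inner)
qed

section \<open>Return to matrix polynomials\<close>

lemma mp_of_T_even: "alternating A \<Longrightarrow> mp_of m A \<in> T_even m"
  by (simp add: T_even_iff alternating_def mp_of_in_matpolys)

lemma solves_iff_mpeval:
  assumes "Q \<in> matpolys m"
  shows "mpeval Q lam *v x = r \<longleftrightarrow> solves (coeff Q)"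
  by (simp add: solves_def mpeval_mult_vec [OF assms])

lemma solves_mp_of: "solves A \<Longrightarrow> mpeval (mp_of m A) lam *v x = r"
  by (simp add: solves_iff_mpeval [OF mp_of_in_matpolys] solves_def)

end


text \<open>On the unit circle with \<open>m\<close> odd, the spectral clause is an equivalence: the
  structured error exceeds the unstructured one unless \<open>tdot x r = 0\<close>.\<close>

theorem theorem3p7:
  fixes P :: "'n::finite matpoly" and m :: nat and lam :: complex and x r :: "complex ^ 'n"
  assumes "m \<ge> 1"
    and "P \<in> T_even m"
    and "regular P"
    and "tdot (conjv x) x = 1"
    and "r = - (mpeval P lam *v x)"
  shows
    "backward_error frobenius_norm m (T_even m) lam x P =
       sqrt ((cmod (tdot x r))\<^sup>2 / (norm2 m (Pi_e (Lam lam)))\<^sup>2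
             + 2 * (((norm r)\<^sup>2 - (cmod (tdot x r))\<^sup>2) / (norm2 m (Lam lam))\<^sup>2))
     \<and> backward_error spectral_norm m (T_even m) lam x P =
       sqrt ((cmod (tdot x r))\<^sup>2 / (norm2 m (Pi_e (Lam lam)))\<^sup>2
             + ((norm r)\<^sup>2 - (cmod (tdot x r))\<^sup>2) / (norm2 m (Lam lam))\<^sup>2)
     \<and> (odd m \<and> cmod lam = 1 \<longrightarrow>
          (\<forall>N \<in> {frobenius_norm, spectral_norm}.
             backward_error frobenius_norm m (T_even m) lam x P =
               sqrt 2 * backward_error N m (matpolys m) lam x P
             \<and> (backward_error spectral_norm m (T_even m) lam x P =
                  backward_error N m (matpolys m) lam x P \<longleftrightarrow> tdot x r = 0)))
     \<and> (let D = mp_of m (E_coeff m lam x r) in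
          D \<in> T_even m
          \<and> mpeval P lam *v x + mpeval D lam *v x = 0
          \<and> mpnorm frobenius_norm m D = backward_error frobenius_norm m (T_even m) lam x P
          \<and> (\<forall>Q \<in> T_even m.
               mpeval P lam *v x + mpeval Q lam *v x = 0
               \<and> mpnorm frobenius_norm m Q = backward_error frobenius_norm m (T_even m) lam x P
               \<longrightarrow> Q = D))
     \<and> (let D = mp_of m (DA_coeff m lam x r) in
          D \<in> T_even m
          \<and> mpeval P lam *v x + mpeval D lam *v x = 0
          \<and> mpnorm spectral_norm m D = backward_error spectral_norm m (T_even m) lam x P)"
proof -
  interpret unit_vector_residual m lam x r
    by unfold_locales (rule assms(4))
  let ?bF = "(cmod xr)\<^sup>2 / P2 + 2 * ((norm s)\<^sup>2 / L2)"
  let ?b2 = "(cmod xr)\<^sup>2 / P2 + (norm s)\<^sup>2 / L2"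
  let ?bU = "(norm r)\<^sup>2 / L2"
  have feas: "mpeval P lam *v x + y = 0 \<longleftrightarrow> y = r" for y
    using assms(5) by (simp add: add_eq_0_iff)
  have T: "alternating (coeff Q)" if "Q \<in> T_even m" for Q
    using that by (simp add: T_even_iff alternating_def)
  have sol: "solves (coeff Q)" if "Q \<in> matpolys m" "mpeval P lam *v x + mpeval Q lam *v x = 0" for Q
    using that by (simp add: feas solves_iff_mpeval)
  have proj: "(mpnorm frobenius_norm m Q)\<^sup>2 = ?bF + (\<Sum>j\<le>m. (norm (coeff Q j - E j))\<^sup>2)"
    if "Q \<in> T_even m" "mpeval P lam *v x + mpeval Q lam *v x = 0" for Q
    using frobenius_projection [OF T sol] that
    by (simp add: mpnorm_def frobenius_norm_eq_norm sum_nonneg T_even_matpolys)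
  have E: "mp_of m E \<in> T_even m" "mpeval P lam *v x + mpeval (mp_of m E) lam *v x = 0"
    by (simp_all add: mp_of_T_even alternating_E feas solves_mp_of solves_E)
  have DA: "mp_of m DA \<in> T_even m" "mpeval P lam *v x + mpeval (mp_of m DA) lam *v x = 0"
    by (simp_all add: mp_of_T_even alternating_DA feas solves_mp_of solves_DA)
  have U: "mp_of m U \<in> matpolys m" "mpeval P lam *v x + mpeval (mp_of m U) lam *v x = 0"
    by (simp_all add: mp_of_in_matpolys feas solves_mp_of solves_U)
  have lower_F: "sqrt ?bF \<le> mpnorm frobenius_norm m Q"
    if "Q \<in> T_even m" "mpeval P lam *v x + mpeval Q lam *v x = 0" for Q
    using frobenius_projection [OF T sol] that
    by (simp add: mpnorm_def frobenius_norm_eq_norm sum_nonneg T_even_matpolys)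
  have upper_F: "mpnorm frobenius_norm m (mp_of m E) \<le> sqrt ?bF"
    by (simp add: mpnorm_def frobenius_norm_eq_norm sum_norm_E)
  have F: "backward_error frobenius_norm m (T_even m) lam x P = sqrt ?bF"
    "mpnorm frobenius_norm m (mp_of m E) = sqrt ?bF"
    by (rule backward_error_eqI [OF E lower_F upper_F]; assumption)+
  have lower_2: "sqrt ?b2 \<le> mpnorm spectral_norm m Q"
    if "Q \<in> T_even m" "mpeval P lam *v x + mpeval Q lam *v x = 0" for Q
    using spectral_lower_bound [OF T sol] that by (simp add: mpnorm_def T_even_matpolys)
  have upper_2: "mpnorm spectral_norm m (mp_of m DA) \<le> sqrt ?b2"
    using spectral_DA by (simp add: mpnorm_def)
  have S: "backward_error spectral_norm m (T_even m) lam x P = sqrt ?b2"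
    "mpnorm spectral_norm m (mp_of m DA) = sqrt ?b2"
    by (rule backward_error_eqI [OF DA lower_2 upper_2]; assumption)+
  have uniq: "Q = mp_of m E"
    if "Q \<in> T_even m" "mpeval P lam *v x + mpeval Q lam *v x = 0"
      "mpnorm frobenius_norm m Q = backward_error frobenius_norm m (T_even m) lam x P" for Q
  proof (rule poly_eqI)
    fix j
    have "0 \<le> ?bF" by simp
    then have "(\<Sum>j\<le>m. (norm (coeff Q j - E j))\<^sup>2) = 0"
      using proj [OF that(1,2)] that(3) by (simp add: F(1))
    then have "\<forall>j\<le>m. coeff Q j = E j"
      by (simp add: sum_nonneg_eq_0_iff)
    \<comment> \<open>Above \<open>m\<close> both coefficients vanish by the degree bound.\<close>
    then show "coeff Q j = coeff (mp_of m E) j"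
      using T_even_matpolys [OF that(1)] by (simp add: matpolys_def coeff_eq_0)
  qed
  have unstructured: "backward_error N m (matpolys m) lam x P = sqrt ?bU"
    if "N \<in> {frobenius_norm, spectral_norm}" for N
  proof (rule backward_error_eqI(1) [OF U])
    \<comment> \<open>These three properties are shared by both norms and suffice for the
      minimum.\<close>
    have N: "norm (A *v x) \<le> N A" "0 \<le> N A" "N A \<le> frobenius_norm A" for A
      using that norm_mult_vec_le_spectral [of A x] norm_mult_vec_le_frobenius [of A x]
        spectral_norm_nonneg [of A] spectral_le_frobenius [of A]
      by (auto simp: frobenius_norm_eq_norm)
    show "sqrt ?bU \<le> mpnorm N m Q"
      if "Q \<in> matpolys m" "mpeval P lam *v x + mpeval Q lam *v x = 0" for Q
    proof -
      have "?bU \<le> (\<Sum>j\<le>m. (norm (coeff Q j *v x))\<^sup>2)"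
        by (rule unstructured_lower_bound [OF sol [OF that]])
      also have "\<dots> \<le> (\<Sum>j\<le>m. (N (coeff Q j))\<^sup>2)"
        by (intro sum_mono power_mono N) simp
      finally show ?thesis by (simp add: mpnorm_def)
    qed
    have "(\<Sum>j\<le>m. (N (U j))\<^sup>2) \<le> ?bU"
      unfolding frobenius_U [symmetric] by (intro sum_mono power_mono N)
    then show "mpnorm N m (mp_of m U) \<le> sqrt ?bU"
      by (simp add: mpnorm_def)
  qed
  \<comment> \<open>With \<open>L2 = 2 * P2\<close> the squared spectral error is
    \<open>(norm r)^2 + |xr|^2\<close> over \<open>L2\<close>, exceeding \<open>?bU\<close> by
    \<open>|xr|^2 / L2\<close>.\<close>
  have circle: "?bF = 2 * ?bU" "?b2 = ?bU \<longleftrightarrow> xr = 0" if unimodular: "odd m" "cmod lam = 1"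
  proof -
    have one: "cmod (lam ^ j) = 1" for j
      using unimodular by (simp add: norm_power)
    \<comment> \<open>Half of the indices \<open>0, ..., 2 * k + 1\<close> are even, each of weight
      1.\<close>
    have "(\<Sum>j\<le>2 * k + 1. if even j then 1 else (0 :: real)) = k + 1" for k :: nat
      by (induction k) auto
    moreover obtain k where "m = 2 * k + 1"
      using unimodular(1) by (rule oddE)
    ultimately have L: "L2 = 2 * P2"
      by (simp add: norm2_Lam norm2_Pi_e one cong: if_cong)
    show "?bF = 2 * ?bU" "?b2 = ?bU \<longleftrightarrow> xr = 0"
      using P2_pos unfolding L norm_s by (simp_all add: field_simps)
  qed
  have unimodular_errors: "backward_error frobenius_norm m (T_even m) lam x P =
        sqrt 2 * backward_error N m (matpolys m) lam x P
      \<and> (backward_error spectral_norm m (T_even m) lam x P =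
          backward_error N m (matpolys m) lam x P \<longleftrightarrow> xr = 0)"
    if "odd m \<and> cmod lam = 1" "N \<in> {frobenius_norm, spectral_norm}" for N
    unfolding F(1) S(1) unstructured [OF that(2)] real_sqrt_eq_iff
      circle [OF conjunct1 [OF that(1)] conjunct2 [OF that(1)]]
    by (simp only: real_sqrt_mult)
  have residual: "(norm r)\<^sup>2 - (cmod xr)\<^sup>2 = (norm s)\<^sup>2"
    by (simp only: norm_s)
  show ?thesis
    unfolding Let_def xr_def [symmetric] residual
    by (intro conjI impI ballI F(1) S(1) E DA F(2) [folded F(1)] S(2) [folded S(1)]
        unimodular_errors [THEN conjunct1] unimodular_errors [THEN conjunct2])
      (auto intro: uniq)
qed

end
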